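(* Let $n\ge 2$, let $G=[g_{ij}]$ be an interaction network on $N=\{1,\dots,n\}$, let $\tau_x,\tau_y>0$, and let $\gamma=\tau_x/(\tau_x+\tau_y)$. The networked beauty contest game has a unique linear equilibrium, and in it agent $i$'s strategy is $$a_i^*=b_i^*\,y+(1-b_i^* )\,x_i ,\qquad i\in N,$$ where $b_i^*=(1-\gamma)\,c_i(\gamma,G)$ is proportional to agent $i$'s Katz-Bonacich centrality $c_i(\gamma,G)$.
   Context: Interaction network: an $n\times n$ real matrix $G=[g_{ij}]$ with $g_{ij}\ge 0$, $g_{ii}=0$, and $d_i^{out}:=\sum_{j\ne i}g_{ij}<1$ for all $i\in N$. Payoffs: agent $i$ chooses $a_i\in\mathbb{R}$; with $a=(a_j)_{j\in N}$ and common state $\theta\in\mathbb{R}$, $$u_i(a,\theta)=-\Big(1-\sum_{j\neq i}g_{ij}\Big)(a_i-\theta)^2-\sum_{j\ne i}g_{ij}(a_i-a_j)^2 .$$ Information: $\theta$ has the improper uniform prior on $\mathbb{R}$. Agent $i$ observes $\mathbf{s}_i=(x_i,y)$, with private signal $x_i=\theta+\varepsilon_i$ and public signal $y=\theta+\varepsilon_y$, where $\varepsilon_i\sim N(0,\tau_x^{-1})$, $\varepsilon_y\sim N(0,\tau_y^{-1})$, and $\theta,\varepsilon_1,\dots,\varepsilon_n,\varepsilon_y$ are jointly independent. $\mathbb{E}_i[\cdot]=\mathbb{E}[\cdot\mid \mathbf{s}_i]$ is the posterior expectation under the improper prior; in particular $\mathbb{E}_i[\theta]=\mathbb{E}_i[x_j]=\gamma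 x_i+(1-\gamma)y$ for $j\ne i$, where $\gamma=\tau_x/(\tau_x+\tau_y)\in(0,1)$. Linear equilibrium: a profile of linear strategies $a_i=b_i^y y+b_i^x x_i$ ($b_i^y,b_i^x\in\mathbb{R}$) such that for every $i$ and every realization of $\mathbf{s}_i$, $a_i$ maximizes $\mathbb{E}_i[u_i(a,\theta)]$ given the others' strategies. Equivalently (first-order condition), $a_i=(1-d_i^{out})\mathbb{E}_i[\theta]+\sum_{j\ne i}g_{ij}\mathbb{E}_i[a_j]$ for all $i$. Katz-Bonacich centrality vector: $\mathbf{c}(\gamma,G)=(c_1(\gamma,G),\dots,c_n(\gamma,G))'=(I-\gamma G)^{-1}\mathbf{1}$, where $\mathbf{1}$ is the all-ones column vector; the inverse exists and is entrywise nonnegative. *)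

theory Defs
  imports "HOL-Probability.Probability"
begin

definition out_degree :: "real^'n^'n \<Rightarrow> 'n::finite \<Rightarrow> real" where
  "out_degree G i = (\<Sum>j\<in>UNIV - {i}. G $ i $ j)"

definition interaction_network :: "real^'n^'n \<Rightarrow> bool" where
  "interaction_network G \<longleftrightarrow>
     (\<forall>i j. 0 \<le> G $ i $ j) \<and> (\<forall>i. G $ i $ i = 0) \<and> (\<forall>i. out_degree G i < 1)"

definition payoff :: "real^'n^'n \<Rightarrow> 'n::finite \<Rightarrow> ('n \<Rightarrow> real) \<Rightarrow> real \<Rightarrow> real" where
  "payoff G i a \<theta> =
     - (1 - (\<Sum>j\<in>UNIV - {i}. G $ i $ j)) * (a i - \<theta>)\<^sup>2
     - (\<Sum>j\<in>UNIV - {i}. G $ i $ j * (a i - a j)\<^sup>2)"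

text \<open>
  Conditionally on the state \<open>\<theta>\<close>, the private signals \<open>x j\<close> and the public signal \<open>y\<close> are
  independent normals with mean \<open>\<theta>\<close> and precisions \<open>\<tau>x\<close> and \<open>\<tau>y\<close>.  The second
  argument of \<^const>\<open>normal_density\<close> is the standard deviation.  Since the improper prior on
  \<open>\<theta>\<close> has density 1, this is also the joint density of \<open>(\<theta>, x, y)\<close> with respect to
  Lebesgue measure (of infinite total mass).
\<close>

definition joint_density :: "real \<Rightarrow> real \<Rightarrow> real \<Rightarrow> ('n::finite \<Rightarrow> real) \<Rightarrow> real \<Rightarrow> real" where
  "joint_density \<tau>x \<tau>y \<theta> x y =
     (\<Prod>j\<in>UNIV. normal_density \<theta> (1 / sqrt \<tau>x) (x j)) * normal_density \<theta> (1 / sqrt \<tau>y) y"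

text \<open>
  The posterior expectation, given \<open>(x i, y) = (xi, y)\<close>, of a random variable
  \<open>Z\<close> depending on \<open>(\<theta>, x, y)\<close>: the joint density is restricted to the section fixed by
  the observed signals and normalised.  The integration variables are \<open>\<theta>\<close> and the unobserved
  private signals \<open>x j\<close> for \<open>j \<noteq> i\<close>; the normalising integral is finite and positive for
  every realization, so this is a posterior for every (not just almost every) signal.
\<close>

definition posterior_expectation ::
  "real \<Rightarrow> real \<Rightarrow> 'n::finite \<Rightarrow> real \<Rightarrow> real \<Rightarrow> (real \<Rightarrow> ('n \<Rightarrow> real) \<Rightarrow> real \<Rightarrow> real) \<Rightarrow> real" where
  "posterior_expectation \<tau>x \<tau>y i xi y Z =
     (\<integral>(\<theta>, x). Z \<theta> (x(i := xi)) y * joint_density \<tau>x \<tau>y \<theta> (x(i := xi)) y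
        \<partial>(lborel \<Otimes>\<^sub>M Pi\<^sub>M (UNIV - {i}) (\<lambda>_. lborel))) /
     (\<integral>(\<theta>, x). joint_density \<tau>x \<tau>y \<theta> (x(i := xi)) y
        \<partial>(lborel \<Otimes>\<^sub>M Pi\<^sub>M (UNIV - {i}) (\<lambda>_. lborel)))"

text \<open>
  A strategy profile \<open>s\<close> assigns to agent \<open>j\<close> and signals \<open>(x j, y)\<close> the action
  \<open>s j (x j) y\<close>.
\<close>

definition linear_profile :: "('n \<Rightarrow> real \<Rightarrow> real \<Rightarrow> real) \<Rightarrow> bool" where
  "linear_profile s \<longleftrightarrow> (\<forall>i. \<exists>by bx. \<forall>xi y. s i xi y = by * y + bx * xi)"

definition interim_payoff ::
  "real^'n^'n \<Rightarrow> real \<Rightarrow> real \<Rightarrow> ('n::finite \<Rightarrow> real \<Rightarrow> real \<Rightarrow> real) \<Rightarrow>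
     'n \<Rightarrow> real \<Rightarrow> real \<Rightarrow> real \<Rightarrow> real" where
  "interim_payoff G \<tau>x \<tau>y s i xi y ai =
     posterior_expectation \<tau>x \<tau>y i xi y (\<lambda>\<theta> x y. payoff G i ((\<lambda>j. s j (x j) y)(i := ai)) \<theta>)"

definition linear_equilibrium ::
  "real^'n^'n \<Rightarrow> real \<Rightarrow> real \<Rightarrow> ('n::finite \<Rightarrow> real \<Rightarrow> real \<Rightarrow> real) \<Rightarrow> bool" where
  "linear_equilibrium G \<tau>x \<tau>y s \<longleftrightarrow>
     linear_profile s \<and>
     (\<forall>i xi y a'. interim_payoff G \<tau>x \<tau>y s i xi y a' \<le> interim_payoff G \<tau>x \<tau>y s i xi y (s i xi y))"

definition katz_bonacich :: "real \<Rightarrow> real^'n^'n \<Rightarrow> real^'n::finite" where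
  "katz_bonacich \<gamma> G = matrix_inv (mat 1 - \<gamma> *\<^sub>R G) *v (\<chi> i. 1)"

text \<open>
  For \<open>0 \<le> \<gamma> \<le> 1\<close> the matrix inverse in the centrality is a genuine inverse.
\<close>

lemma invertible_katz_bonacich:
  fixes G :: "real^'n::finite^'n"
  assumes G: "interaction_network G" and \<gamma>: "0 \<le> \<gamma>" "\<gamma> \<le> 1"
  shows "invertible (mat 1 - \<gamma> *\<^sub>R G)"
proof -
  have "v = 0" if v: "(mat 1 - \<gamma> *\<^sub>R G) *v v = 0" for v :: "real^'n"
  proof -
    have eq: "v $ i = \<gamma> * (\<Sum>j\<in>UNIV. G $ i $ j * v $ j)" for i
    proof -
      have "v - \<gamma> *\<^sub>R (G *v v) = 0"
        using v by (simp add: matrix_vector_mult_diff_rdistrib scaleR_matrix_vector_assoc)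
      then have "(v - \<gamma> *\<^sub>R (G *v v)) $ i = 0" by simp
      then show ?thesis by (simp add: matrix_vector_mult_def)
    qed
    define m where "m = Max (range (\<lambda>i. \<bar>v $ i\<bar>))"
    have le: "\<bar>v $ i\<bar> \<le> m" for i unfolding m_def by (rule Max_ge) auto
    have "m \<in> range (\<lambda>i. \<bar>v $ i\<bar>)" unfolding m_def by (rule Max_in) auto
    then obtain i where i: "m = \<bar>v $ i\<bar>" by auto
    have m0: "0 \<le> m" using i by simp
    have nn: "0 \<le> G $ i $ j" for j using G by (simp add: interaction_network_def)
    have d: "(\<Sum>j\<in>UNIV. G $ i $ j) = out_degree G i"
      using G unfolding out_degree_def interaction_network_def
      by (subst sum.remove[of UNIV i]) auto
    have d1: "out_degree G i < 1" using G by (simp add: interaction_network_def)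
    have d0: "0 \<le> out_degree G i" unfolding d[symmetric] by (rule sum_nonneg) (rule nn)
    have "m = \<gamma> * \<bar>\<Sum>j\<in>UNIV. G $ i $ j * v $ j\<bar>"
      using i eq[of i] \<gamma> by (simp add: abs_mult)
    also have "\<dots> \<le> \<gamma> * (out_degree G i * m)"
    proof (rule mult_left_mono[OF _ \<gamma>(1)])
      have "\<bar>\<Sum>j\<in>UNIV. G $ i $ j * v $ j\<bar> \<le> (\<Sum>j\<in>UNIV. \<bar>G $ i $ j * v $ j\<bar>)" by (rule sum_abs)
      also have "\<dots> \<le> (\<Sum>j\<in>UNIV. G $ i $ j * m)"
        by (rule sum_mono) (simp add: abs_mult nn le mult_left_mono)
      finally show "\<bar>\<Sum>j\<in>UNIV. G $ i $ j * v $ j\<bar> \<le> out_degree G i * m"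
        by (simp add: sum_distrib_right[symmetric] d)
    qed
    also have "\<dots> \<le> out_degree G i * m"
      using \<gamma> d0 m0 by (simp add: mult_left_le_one_le)
    finally have "(1 - out_degree G i) * m \<le> 0" by (simp add: algebra_simps)
    then have "m \<le> 0" using d1 by (simp add: mult_le_0_iff)
    then have "v $ j = 0" for j using le[of j] by simp
    then show "v = 0" by (simp add: vec_eq_iff)
  qed
  then show ?thesis
    by (simp add: invertible_left_inverse matrix_left_invertible_ker)
qed

end

theory Submission
  imports Defs
begin

text \<open>
  Given the signals \<open>(x i, y)\<close>, the state is normal with mean \<open>m = \<gamma> * x i + (1 - \<gamma>) * y\<close>, and
  so the interim payoff against linear strategies \<open>v j * y + u j * x j\<close> is a constant minus
  \<open>(a - t)\<^sup>2\<close>, where \<open>t\<close> is the average of \<open>m\<close> and the \<open>v j * y + u j * m\<close> with weights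
  \<open>1 - out_degree G i\<close> and \<open>G $ i $ j\<close>. Hence the best response is \<open>t\<close>. Comparing coefficients of
  the signals, \<open>1 - (u + v)\<close> is a fixed point of \<open>G\<close>, hence zero, and \<open>w = 1 - u = v\<close> solves
  \<open>(I - \<gamma> G) w = (1 - \<gamma>) 1\<close>, which is the scaled centrality.
\<close>

section \<open>Normal moments and completing the square\<close>

text \<open>Writing \<open>c - b * x\<close> as \<open>(c - b * \<mu>) - b * (x - \<mu>)\<close>,
  only the central moments 1, 0 and \<open>\<sigma>\<^sup>2\<close> enter. The offset
  \<open>e\<close> leaves room for a variance produced by an earlier integration.\<close>

lemma has_bochner_integral_normal_square:
  assumes "0 < \<sigma>"
  shows "has_bochner_integral lborel (\<lambda>x. ((c - b * x)\<^sup>2 + e) * normal_density \<mu> \<sigma> x)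
           ((c - b * \<mu>)\<^sup>2 + b\<^sup>2 * \<sigma>\<^sup>2 + e)"
proof -
  have 0: "has_bochner_integral lborel (\<lambda>x. normal_density \<mu> \<sigma> x * (x - \<mu>) ^ (2 * 0)) 1"
    using normal_moment_even[OF assms, of \<mu> 0] by simp
  have 1: "has_bochner_integral lborel (\<lambda>x. normal_density \<mu> \<sigma> x * (x - \<mu>) ^ (2 * 0 + 1)) 0"
    using normal_moment_odd[OF assms, of \<mu> 0] by simp
  have 2: "has_bochner_integral lborel (\<lambda>x. normal_density \<mu> \<sigma> x * (x - \<mu>) ^ (2 * 1)) (\<sigma>\<^sup>2)"
    using normal_moment_even[OF assms, of \<mu> 1] by (simp add: eval_nat_numeral)
  have "has_bochner_integral lborel
     (\<lambda>x. ((c - b * \<mu>)\<^sup>2 + e) * (normal_density \<mu> \<sigma> x * (x - \<mu>) ^ (2 * 0))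
        + (- 2 * b * (c - b * \<mu>)) * (normal_density \<mu> \<sigma> x * (x - \<mu>) ^ (2 * 0 + 1))
        + b\<^sup>2 * (normal_density \<mu> \<sigma> x * (x - \<mu>) ^ (2 * 1)))
     (((c - b * \<mu>)\<^sup>2 + e) * 1 + (- 2 * b * (c - b * \<mu>)) * 0 + b\<^sup>2 * \<sigma>\<^sup>2)"
    by (intro has_bochner_integral_add has_bochner_integral_mult_right 0 1 2)
  then show ?thesis
    by (rule has_bochner_integral_cong[THEN iffD1, rotated 3])
       (auto simp: power2_eq_square algebra_simps)
qed

lemma nn_integral_normal_square:
  assumes "0 < \<sigma>" "0 \<le> e"
  shows "(\<integral>\<^sup>+x. ennreal (((c - b * x)\<^sup>2 + e) * normal_density \<mu> \<sigma> x) \<partial>lborel)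
           = ennreal ((c - b * \<mu>)\<^sup>2 + b\<^sup>2 * \<sigma>\<^sup>2 + e)"
  using has_bochner_integral_normal_square[OF assms(1), of c b e \<mu>] assms(2)
  by (subst nn_integral_eq_integral)
     (auto simp: has_bochner_integral_iff)

text \<open>Completing the square in \<open>\<theta>\<close>: precisions add, and the mean is the
  precision-weighted average of the signals. \<open>K\<close> does not depend on
  \<open>\<theta>\<close>, so it cancels in the posterior; hence only its positivity is
  recorded.\<close>

lemma normal_density_fusion:
  fixes s t x y :: real
  assumes s: "0 < s" and t: "0 < t"
  obtains K where "0 < K"
    "\<And>\<theta>. normal_density \<theta> (1 / sqrt s) x * normal_density \<theta> (1 / sqrt t) y
       = K * normal_density (s / (s + t) * x + (1 - s / (s + t)) * y) (1 / sqrt (s + t)) \<theta>"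
proof -
  define m where "m = s / (s + t) * x + (1 - s / (s + t)) * y"
  \<comment> \<open>\<open>C u\<close> is the normalising constant of a normal density of precision
    \<open>u\<close>; the exponential in \<open>K\<close> is the part of the completed square that
    is free of \<open>\<theta>\<close>.\<close>
  define C where "C u = 1 / sqrt (2 * pi * (1 / sqrt u)\<^sup>2)" for u
  define K where "K = C s * C t / C (s + t) * exp (- (s * t / (2 * (s + t)) * (x - y)\<^sup>2))"
  have C: "0 < C u" if "0 < u" for u using that by (simp add: C_def)
  have N: "normal_density \<mu> (1 / sqrt u) z = C u * exp (- (u / 2 * (z - \<mu>)\<^sup>2))" if "0 < u" for u \<mu> z
    using that by (simp add: C_def normal_density_def power_divide field_simps)
  have sq: "s / 2 * (x - \<theta>)\<^sup>2 + t / 2 * (y - \<theta>)\<^sup>2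
      = s * t / (2 * (s + t)) * (x - y)\<^sup>2 + (s + t) / 2 * (\<theta> - m)\<^sup>2" for \<theta>
  proof -
    have "1 - s / (s + t) = t / (s + t)" using s t by (simp add: field_simps)
    then have "m = (s * x + t * y) / (s + t)" by (simp add: m_def add_divide_distrib)
    then show ?thesis using s t
      by (simp only:) (simp add: divide_simps power2_eq_square, simp add: algebra_simps)
  qed
  have "normal_density \<theta> (1 / sqrt s) x * normal_density \<theta> (1 / sqrt t) y
      = C s * C t * exp (- (s / 2 * (x - \<theta>)\<^sup>2 + t / 2 * (y - \<theta>)\<^sup>2))" for \<theta>
    using s t by (simp only: N minus_add_distrib exp_add mult_ac)
  also have "\<dots> \<theta> = K * normal_density m (1 / sqrt (s + t)) \<theta>" for \<theta>
    unfolding sq minus_add_distrib exp_add using s t C[of "s + t"] by (simp add: N K_def)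
  finally show ?thesis
    using s t C that[of K] by (simp add: K_def m_def)
qed

section \<open>Integration over the state and the unobserved signals\<close>

text \<open>The integrand factorises over \<open>I\<close>, and every factor but that of
  \<open>j\<close> integrates to 1.\<close>

lemma nn_integral_PiM_normal_component:
  fixes I :: "'i::finite set"
  assumes j: "j \<in> I" and \<sigma>: "0 < \<sigma>" and f: "f \<in> borel_measurable borel" "\<And>x. 0 \<le> f x"
  shows "(\<integral>\<^sup>+x. ennreal (f (x j) * (\<Prod>k\<in>I. normal_density \<mu> \<sigma> (x k))) \<partial>Pi\<^sub>M I (\<lambda>_. lborel))
           = (\<integral>\<^sup>+z. ennreal (f z * normal_density \<mu> \<sigma> z) \<partial>lborel)"
proof -
  interpret product_sigma_finite "\<lambda>_::'i. lborel :: real measure"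
    by unfold_locales
  \<comment> \<open>Absorbing \<open>f\<close> into coordinate \<open>j\<close> makes the integrand
    a product of one-variable functions.\<close>
  define h where "h k z = ennreal ((if k = j then f z else 1) * normal_density \<mu> \<sigma> z)" for k z
  note f(1)[measurable]
  have h[measurable]: "h k \<in> borel_measurable lborel" for k
    unfolding h_def by (cases "k = j") auto
  have "ennreal (f (x j) * (\<Prod>k\<in>I. normal_density \<mu> \<sigma> (x k))) = (\<Prod>k\<in>I. h k (x k))" for x
    using j f(2) by (simp add: h_def prod_ennreal prod.distrib if_distrib[of "\<lambda>f. f _"] prod.delta
        cong: if_cong)
  then have "(\<integral>\<^sup>+x. ennreal (f (x j) * (\<Prod>k\<in>I. normal_density \<mu> \<sigma> (x k))) \<partial>Pi\<^sub>M I (\<lambda>_. lborel))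
      = (\<Prod>k\<in>I. integral\<^sup>N lborel (h k))"
    by (simp add: product_nn_integral_prod)
  also have "integral\<^sup>N lborel (h k) = 1" if "k \<noteq> j" for k
    using nn_integral_eq_integral[OF integrable_normal_density[OF \<sigma>, of \<mu>]] that \<sigma>
    by (simp add: h_def[abs_def])
  then have "(\<Prod>k\<in>I. integral\<^sup>N lborel (h k)) = integral\<^sup>N lborel (h j)"
    using j by (subst prod.remove[of I j]) auto
  finally show ?thesis by (simp add: h_def[abs_def])
qed

text \<open>
  All integrands of the payoff are squares, so Tonelli's theorem for nonnegative integrals yields
  integrability and value at once.
\<close>

lemma joint_density_moment:
  fixes i j :: "'n::finite" and xi y :: real
  assumes ij: "j \<noteq> i" and \<tau>: "0 < \<tau>x" "0 < \<tau>y"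
    and K: "0 < K"
      "\<And>\<theta>. normal_density \<theta> (1 / sqrt \<tau>x) xi * normal_density \<theta> (1 / sqrt \<tau>y) y
         = K * normal_density m (1 / sqrt (\<tau>x + \<tau>y)) \<theta>"
  shows "has_bochner_integral (lborel \<Otimes>\<^sub>M Pi\<^sub>M (UNIV - {i}) (\<lambda>_. lborel))
     (\<lambda>(\<theta>, x). (c - e * \<theta> - b * x j)\<^sup>2 * joint_density \<tau>x \<tau>y \<theta> (x(i := xi)) y)
     (K * ((c - (e + b) * m)\<^sup>2 + (e + b)\<^sup>2 / (\<tau>x + \<tau>y) + b\<^sup>2 / \<tau>x))"
proof -
  interpret product_sigma_finite "\<lambda>_::'n. lborel :: real measure"
    by unfold_locales
  let ?J = "UNIV - {i}" and ?P = "Pi\<^sub>M (UNIV - {i}) (\<lambda>_::'n. lborel :: real measure)"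
  interpret J: sigma_finite_measure ?P by (rule sigma_finite) simp
  let ?\<sigma> = "1 / sqrt \<tau>x" and ?w = "\<lambda>\<theta>. K * normal_density m (1 / sqrt (\<tau>x + \<tau>y)) \<theta>"
  \<comment> \<open>The densities of the two observed signals fuse to \<open>?w\<close>; a product
    over the unobserved signals remains.\<close>
  have jd: "joint_density \<tau>x \<tau>y \<theta> (x(i := xi)) y
      = (\<Prod>k\<in>?J. normal_density \<theta> ?\<sigma> (x k)) * ?w \<theta>" for \<theta> x
    unfolding joint_density_def K(2)[symmetric]
    by (subst prod.remove[of UNIV i]) auto
  have comp[measurable]: "(\<lambda>x. x k) \<in> borel_measurable ?P" if "k \<in> ?J" for k
    using measurable_component_singleton[OF that, of "\<lambda>_. lborel :: real measure"] by simp
  have j[measurable]: "(\<lambda>x. x j) \<in> borel_measurable ?P" using ij by (intro comp) simp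
  \<comment> \<open>Stated for arbitrary measurable \<open>f\<close> and \<open>g\<close>, so that
    it serves both on the pair space and for fixed \<open>\<theta>\<close>.\<close>
  have dens[measurable]: "(\<lambda>p. \<Prod>k\<in>?J. normal_density (f p) ?\<sigma> (g p k)) \<in> borel_measurable M"
    if [measurable]: "f \<in> borel_measurable M" "g \<in> measurable M ?P"
    for M :: "'b measure" and f :: "'b \<Rightarrow> real" and g :: "'b \<Rightarrow> 'n \<Rightarrow> real"
  proof (rule borel_measurable_prod)
    fix k assume k: "k \<in> ?J"
    have [measurable]: "(\<lambda>p. g p k) \<in> borel_measurable M"
      by (rule measurable_compose[OF that(2) comp[OF k]])
    show "(\<lambda>p. normal_density (f p) ?\<sigma> (g p k)) \<in> borel_measurable M"
      unfolding normal_density_def by measurable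
  qed
  have meas[measurable]: "(\<lambda>(\<theta>, x). (c - e * \<theta> - b * x j)\<^sup>2 * ((\<Prod>k\<in>?J. normal_density \<theta> ?\<sigma> (x k)) * ?w \<theta>))
      \<in> borel_measurable (lborel \<Otimes>\<^sub>M ?P)"
    by measurable
  \<comment> \<open>Inner integral at fixed \<open>\<theta>\<close>: \<open>x j\<close> has mean
    \<open>\<theta>\<close> and variance \<open>1 / \<tau>x\<close>, so \<open>b * x j\<close>
    contributes \<open>b * \<theta>\<close> to the square and the variance
    \<open>b\<^sup>2 / \<tau>x\<close> beside it.\<close>
  have "(\<integral>\<^sup>+x. ennreal ((c - e * \<theta> - b * x j)\<^sup>2 * ((\<Prod>k\<in>?J. normal_density \<theta> ?\<sigma> (x k)) * ?w \<theta>)) \<partial>?P)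
     = ennreal (K * (((c - (e + b) * \<theta>)\<^sup>2 + b\<^sup>2 / \<tau>x) * normal_density m (1 / sqrt (\<tau>x + \<tau>y)) \<theta>))" for \<theta>
  proof -
    have m[measurable]: "(\<lambda>x. (c - e * \<theta> - b * x j)\<^sup>2 * (\<Prod>k\<in>?J. normal_density \<theta> ?\<sigma> (x k))) \<in> borel_measurable ?P"
      by measurable
    have "(\<integral>\<^sup>+x. ennreal ((c - e * \<theta> - b * x j)\<^sup>2 * ((\<Prod>k\<in>?J. normal_density \<theta> ?\<sigma> (x k)) * ?w \<theta>)) \<partial>?P)
        = (\<integral>\<^sup>+x. ennreal ((c - e * \<theta> - b * x j)\<^sup>2 * (\<Prod>k\<in>?J. normal_density \<theta> ?\<sigma> (x k))) * ennreal (?w \<theta>) \<partial>?P)"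
      using K(1) by (intro nn_integral_cong) (simp add: ennreal_mult[symmetric] prod_nonneg mult.assoc)
    also have "\<dots> = (\<integral>\<^sup>+x. ennreal ((c - e * \<theta> - b * x j)\<^sup>2 * (\<Prod>k\<in>?J. normal_density \<theta> ?\<sigma> (x k))) \<partial>?P) * ennreal (?w \<theta>)"
      by (rule nn_integral_multc) measurable
    also have "(\<integral>\<^sup>+x. ennreal ((c - e * \<theta> - b * x j)\<^sup>2 * (\<Prod>k\<in>?J. normal_density \<theta> ?\<sigma> (x k))) \<partial>?P)
        = (\<integral>\<^sup>+z. ennreal ((c - e * \<theta> - b * z)\<^sup>2 * normal_density \<theta> ?\<sigma> z) \<partial>lborel)"
      using ij \<tau> by (intro nn_integral_PiM_normal_component) auto
    also have "\<dots> = ennreal ((c - e * \<theta> - b * \<theta>)\<^sup>2 + b\<^sup>2 * ?\<sigma>\<^sup>2)"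
      using nn_integral_normal_square[of ?\<sigma> 0 "c - e * \<theta>" b \<theta>] \<tau> by simp
    finally show ?thesis
      using \<tau> K(1) by (simp add: ennreal_mult[symmetric] power_divide algebra_simps)
  qed
  then have "(\<integral>\<^sup>+p. ennreal ((\<lambda>(\<theta>, x). (c - e * \<theta> - b * x j)\<^sup>2 * ((\<Prod>k\<in>?J. normal_density \<theta> ?\<sigma> (x k)) * ?w \<theta>)) p)
        \<partial>(lborel \<Otimes>\<^sub>M ?P))
     = (\<integral>\<^sup>+\<theta>. ennreal (K * (((c - (e + b) * \<theta>)\<^sup>2 + b\<^sup>2 / \<tau>x) * normal_density m (1 / sqrt (\<tau>x + \<tau>y)) \<theta>)) \<partial>lborel)"
    by (subst J.nn_integral_fst[symmetric]) (auto intro!: measurable_compose[OF meas])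
  also have "\<dots> = ennreal K * (\<integral>\<^sup>+\<theta>. ennreal (((c - (e + b) * \<theta>)\<^sup>2 + b\<^sup>2 / \<tau>x) * normal_density m (1 / sqrt (\<tau>x + \<tau>y)) \<theta>) \<partial>lborel)"
    using K(1) \<tau> by (subst nn_integral_cmult[symmetric]) (auto simp: ennreal_mult)
  \<comment> \<open>In the outer integral the inner variance \<open>b\<^sup>2 / \<tau>x\<close>
    plays the part of the offset.\<close>
  also have "\<dots> = ennreal (K * ((c - (e + b) * m)\<^sup>2 + (e + b)\<^sup>2 / (\<tau>x + \<tau>y) + b\<^sup>2 / \<tau>x))"
    using K(1) \<tau> by (subst nn_integral_normal_square) (auto simp: ennreal_mult[symmetric] power_divide simp del: ennreal_plus)
  finally show ?thesis
    unfolding jd using K(1) \<tau>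
    by (intro has_bochner_integral_nn_integral meas) (auto intro!: mult_nonneg_nonneg add_nonneg_nonneg prod_nonneg)
qed

section \<open>Interim payoffs and best responses\<close>

text \<open>The posterior mean of each square is a squared distance to a posterior mean plus a
  variance free of \<open>a\<close>. The weights \<open>1 - out_degree G i\<close> and
  \<open>G $ i $ j\<close> sum to 1, so the quadratic in \<open>a\<close> has leading coefficient -1
  and vertex \<open>t\<close>; \<open>C\<close> absorbs the rest.\<close>

lemma interim_payoff_linear:
  fixes G :: "real^'n::finite^'n"
  assumes n: "CARD('n) \<ge> 2" and \<tau>: "0 < \<tau>x" "0 < \<tau>y"
    and s: "\<And>j x y. s j x y = v j * y + u j * x"
    and m: "m = \<tau>x / (\<tau>x + \<tau>y) * xi + (1 - \<tau>x / (\<tau>x + \<tau>y)) * y"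
    and t: "t = (1 - out_degree G i) * m + (\<Sum>j\<in>UNIV - {i}. G $ i $ j * (v j * y + u j * m))"
  obtains C where "\<And>a. interim_payoff G \<tau>x \<tau>y s i xi y a = C - (a - t)\<^sup>2"
proof -
  obtain K where K: "0 < K"
    "\<And>\<theta>. normal_density \<theta> (1 / sqrt \<tau>x) xi * normal_density \<theta> (1 / sqrt \<tau>y) y
       = K * normal_density m (1 / sqrt (\<tau>x + \<tau>y)) \<theta>"
    using normal_density_fusion[OF \<tau>, of xi y] m by metis
  \<comment> \<open>The moment formula refers to the signal of some agent other than
    \<open>i\<close>. Such an agent exists by \<open>n\<close>, and \<open>b = 0\<close> removes its
    signal again in \<open>D\<close> and \<open>own\<close>.\<close>
  obtain k where k: "k \<noteq> i"
  proof -
    have "\<exists>k. k \<noteq> i"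
    proof (rule ccontr)
      assume "\<nexists>k. k \<noteq> i"
      then have "(UNIV :: 'n set) = {i}" by auto
      then have "CARD('n) = card {i}" by (rule arg_cong)
      then show False using n by simp
    qed
    then show ?thesis using that by blast
  qed
  define \<mu> where "\<mu> = (lborel \<Otimes>\<^sub>M Pi\<^sub>M (UNIV - {i}) (\<lambda>_. lborel) :: (real \<times> ('n \<Rightarrow> real)) measure)"
  define D where "D = (\<lambda>(\<theta>, x). joint_density \<tau>x \<tau>y \<theta> (x(i := xi)) y)"
  \<comment> \<open>\<open>V j\<close> is the posterior variance of the action of \<open>j\<close>:
    uncertainty about the state plus the noise in \<open>x j\<close>.\<close>
  define V where "V j = u j ^ 2 / (\<tau>x + \<tau>y) + u j ^ 2 / \<tau>x" for j
  let ?J = "UNIV - {i}" and ?d = "out_degree G i"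
  note moment = joint_density_moment[where i = i, OF _ \<tau> K, folded \<mu>_def]
  \<comment> \<open>With \<open>c = 1\<close> and \<open>e = b = 0\<close> the moment is the
    normalising integral, so dividing by it cancels \<open>K\<close>.\<close>
  have D: "has_bochner_integral \<mu> D K"
    using moment[OF k, of 1 0 0] by (simp add: D_def)
  have own: "has_bochner_integral \<mu> (\<lambda>p. (a - fst p)\<^sup>2 * D p) (K * ((a - m)\<^sup>2 + 1 / (\<tau>x + \<tau>y)))" for a
    using moment[OF k, of a 1 0] by (simp add: D_def case_prod_beta')
  have other: "has_bochner_integral \<mu> (\<lambda>p. (a - (v j * y + u j * snd p j))\<^sup>2 * D p)
      (K * ((a - (v j * y + u j * m))\<^sup>2 + V j))" if "j \<in> ?J" for a j
    using moment[where j = j and c = "a - v j * y" and e = 0 and b = "u j"] that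
    by (simp add: D_def V_def case_prod_beta' algebra_simps)
  define P where "P a = - (1 - ?d) * ((a - m)\<^sup>2 + 1 / (\<tau>x + \<tau>y))
      - (\<Sum>j\<in>?J. G $ i $ j * ((a - (v j * y + u j * m))\<^sup>2 + V j))" for a
  have payoff_P: "interim_payoff G \<tau>x \<tau>y s i xi y a = P a" for a
  proof -
    have "has_bochner_integral \<mu>
        (\<lambda>p. - (1 - ?d) * ((a - fst p)\<^sup>2 * D p)
           - (\<Sum>j\<in>?J. G $ i $ j * ((a - (v j * y + u j * snd p j))\<^sup>2 * D p)))
        (- (1 - ?d) * (K * ((a - m)\<^sup>2 + 1 / (\<tau>x + \<tau>y)))
           - (\<Sum>j\<in>?J. G $ i $ j * (K * ((a - (v j * y + u j * m))\<^sup>2 + V j))))"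
      by (intro has_bochner_integral_diff has_bochner_integral_sum has_bochner_integral_mult_right own other)
    also have "(\<lambda>p. - (1 - ?d) * ((a - fst p)\<^sup>2 * D p)
           - (\<Sum>j\<in>?J. G $ i $ j * ((a - (v j * y + u j * snd p j))\<^sup>2 * D p)))
        = (\<lambda>(\<theta>, x). payoff G i ((\<lambda>j. s j ((x(i := xi)) j) y)(i := a)) \<theta>
             * joint_density \<tau>x \<tau>y \<theta> (x(i := xi)) y)"
      by (auto simp: fun_eq_iff payoff_def out_degree_def[symmetric] s D_def left_diff_distrib
          sum_distrib_right mult.assoc intro!: sum.cong)
    finally show ?thesis
      using D K(1) unfolding interim_payoff_def posterior_expectation_def \<mu>_def[symmetric]
      by (simp add: has_bochner_integral_iff D_def P_def diff_divide_distrib sum_divide_distrib)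
  qed
  have P_square: "P a = P t - (a - t)\<^sup>2" for a
  proof -
    let ?q = "\<lambda>j. v j * y + u j * m"
    \<comment> \<open>Passing from \<open>t\<close> to \<open>a\<close> shifts each square by a term
      affine in its target \<open>q\<close>, so only the weighted average of the targets
      matters.\<close>
    have sq: "(a - q)\<^sup>2 + e = ((t - q)\<^sup>2 + e) + ((a\<^sup>2 - t\<^sup>2) - 2 * (a - t) * q)" for q e
      by (simp add: power2_eq_square algebra_simps)
    have lin: "(\<Sum>j\<in>?J. G $ i $ j * (A - B * f j)) = ?d * A - B * (\<Sum>j\<in>?J. G $ i $ j * f j)" for A B f
      by (simp add: out_degree_def right_diff_distrib sum_subtractf sum_distrib_right
          sum_distrib_left mult.left_commute)
    have "P a = P t - (1 - ?d) * ((a\<^sup>2 - t\<^sup>2) - 2 * (a - t) * m)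
        - (\<Sum>j\<in>?J. G $ i $ j * ((a\<^sup>2 - t\<^sup>2) - 2 * (a - t) * ?q j))"
      unfolding P_def sq distrib_left sum.distrib by (simp del: minus_diff_eq)
    also have "\<dots> = P t - (1 - ?d) * ((a\<^sup>2 - t\<^sup>2) - 2 * (a - t) * m)
        - (?d * (a\<^sup>2 - t\<^sup>2) - 2 * (a - t) * (t - (1 - ?d) * m))"
    proof -
      have "(\<Sum>j\<in>?J. G $ i $ j * ?q j) = t - (1 - ?d) * m" by (simp add: t)
      then show ?thesis by (simp only: lin)
    qed
    finally show ?thesis by (simp add: power2_eq_square algebra_simps)
  qed
  show ?thesis by (rule that) (rule trans[OF payoff_P P_square])
qed

lemma linear_equilibrium_iff_best_response:
  fixes G :: "real^'n::finite^'n"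
  assumes n: "CARD('n) \<ge> 2" and \<tau>: "0 < \<tau>x" "0 < \<tau>y" and \<gamma>: "\<gamma> = \<tau>x / (\<tau>x + \<tau>y)"
    and s: "\<And>j x y. s j x y = v j * y + u j * x"
  shows "linear_equilibrium G \<tau>x \<tau>y s \<longleftrightarrow>
    (\<forall>i x y. v i * y + u i * x = (1 - out_degree G i) * (\<gamma> * x + (1 - \<gamma>) * y)
       + (\<Sum>j\<in>UNIV - {i}. G $ i $ j * (v j * y + u j * (\<gamma> * x + (1 - \<gamma>) * y))))"
    (is "_ \<longleftrightarrow> (\<forall>i x y. _ = ?t i x y)")
proof -
  have "linear_profile s" unfolding linear_profile_def by (intro allI exI) (rule s)
  moreover have "(\<forall>a. interim_payoff G \<tau>x \<tau>y s i x y a \<le> interim_payoff G \<tau>x \<tau>y s i x y (s i x y))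
      \<longleftrightarrow> s i x y = ?t i x y" for i x y
  proof -
    obtain C where C: "\<And>a. interim_payoff G \<tau>x \<tau>y s i x y a = C - (a - ?t i x y)\<^sup>2"
      by (rule interim_payoff_linear[where G = G and s = s and v = v and u = u and i = i and xi = x and y = y,
            OF n \<tau> s refl refl, folded \<gamma>]) (rule that)
    \<comment> \<open>A deviation to the target itself bounds the squared distance from the target
      by 0.\<close>
    have "s i x y = ?t i x y" if "\<forall>a. interim_payoff G \<tau>x \<tau>y s i x y a \<le> interim_payoff G \<tau>x \<tau>y s i x y (s i x y)"
    proof -
      have "(s i x y - ?t i x y)\<^sup>2 \<le> 0" using that[rule_format, of "?t i x y"] unfolding C by simp
      then show ?thesis by simp
    qed
    then show ?thesis by (auto simp: C)
  qed
  ultimately show ?thesis by (simp add: linear_equilibrium_def s)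
qed

section \<open>Coefficient equations and centrality\<close>

text \<open>As the diagonal of \<open>G\<close> vanishes, the system reads
  \<open>(I - \<gamma> G) w = k 1\<close>, and invertibility yields its only solution. Admitting
  \<open>\<gamma> = 1\<close> lets \<open>k = 0\<close> express that a fixed point of
  \<open>G\<close> is zero.\<close>

lemma interaction_network_fixed_point_iff:
  fixes G :: "real^'n::finite^'n" and w :: "'n \<Rightarrow> real"
  assumes G: "interaction_network G" and \<gamma>: "0 \<le> \<gamma>" "\<gamma> \<le> 1"
  shows "(\<forall>i. w i = k + \<gamma> * (\<Sum>j\<in>UNIV - {i}. G $ i $ j * w j))
    \<longleftrightarrow> (\<forall>i. w i = k * katz_bonacich \<gamma> G $ i)"
proof -
  let ?A = "mat 1 - \<gamma> *\<^sub>R G" and ?w = "\<chi> i. w i" and ?e = "(\<chi> i. 1) :: real^'n"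
  have inv: "invertible ?A" using G \<gamma> by (rule invertible_katz_bonacich)
  \<comment> \<open>\<open>matrix_inv\<close> is defined by choice, so its two laws come from
    invertibility.\<close>
  have inv': "?A ** matrix_inv ?A = mat 1" "matrix_inv ?A ** ?A = mat 1"
    using someI_ex[OF inv[unfolded invertible_def]] by (simp_all add: matrix_inv_def)
  have off: "(\<Sum>j\<in>UNIV - {i}. G $ i $ j * w j) = (\<Sum>j\<in>UNIV. G $ i $ j * w j)" for i
    using G by (subst sum.remove[of UNIV i]) (auto simp: interaction_network_def)
  have A: "?A *v ?w = ?w - \<gamma> *\<^sub>R (G *v ?w)"
    by (simp add: matrix_vector_mult_diff_rdistrib scaleR_matrix_vector_assoc)
  have "(\<forall>i. w i = k + \<gamma> * (\<Sum>j\<in>UNIV - {i}. G $ i $ j * w j)) \<longleftrightarrow> ?A *v ?w = k *\<^sub>R ?e"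
    unfolding A vec_eq_iff by (simp add: off matrix_vector_mult_def diff_eq_eq)
  also have "\<dots> \<longleftrightarrow> ?w = matrix_inv ?A *v (k *\<^sub>R ?e)"
    by (auto simp: matrix_vector_mul_assoc inv' dest: arg_cong[where f = "\<lambda>x. matrix_inv ?A *v x"])
  also have "\<dots> \<longleftrightarrow> (\<forall>i. w i = k * katz_bonacich \<gamma> G $ i)"
    by (simp add: katz_bonacich_def vec_eq_iff matrix_vector_mult_scaleR)
  finally show ?thesis .
qed

text \<open>Matching the coefficients of \<open>x\<close> and \<open>y\<close> gives two coupled
  linear systems; passing to the unknowns \<open>1 - (u i + v i)\<close> and \<open>1 - u i\<close>
  decouples them.\<close>

lemma equilibrium_coefficients_iff:
  fixes G :: "real^'n::finite^'n" and u v :: "'n \<Rightarrow> real"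
  assumes G: "interaction_network G" and \<gamma>: "0 \<le> \<gamma>" "\<gamma> \<le> 1"
  shows "(\<forall>i x y. v i * y + u i * x = (1 - out_degree G i) * (\<gamma> * x + (1 - \<gamma>) * y)
       + (\<Sum>j\<in>UNIV - {i}. G $ i $ j * (v j * y + u j * (\<gamma> * x + (1 - \<gamma>) * y))))
    \<longleftrightarrow> (\<forall>i. v i = (1 - \<gamma>) * katz_bonacich \<gamma> G $ i \<and> u i = 1 - v i)"
    (is "?L \<longleftrightarrow> ?R")
proof -
  let ?S = "\<lambda>i f. \<Sum>j\<in>UNIV - {i}. G $ i $ j * f j"
  have rhs: "(1 - out_degree G i) * (\<gamma> * x + (1 - \<gamma>) * y)
       + (\<Sum>j\<in>UNIV - {i}. G $ i $ j * (v j * y + u j * (\<gamma> * x + (1 - \<gamma>) * y)))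
    = ((1 - out_degree G i) * (1 - \<gamma>) + ?S i v + (1 - \<gamma>) * ?S i u) * y
      + \<gamma> * (1 - out_degree G i + ?S i u) * x" for i x y
    by (simp add: distrib_left distrib_right sum.distrib sum_distrib_left sum_distrib_right
        sum_subtractf left_diff_distrib right_diff_distrib mult_ac)
  have coeff: "(\<forall>x y. p * y + q * x = p' * y + q' * x) \<longleftrightarrow> p = p' \<and> q = q'" for p q p' q' :: real
    by (metis add.right_neutral add_0 mult.right_neutral mult_zero_right)
  have S1: "?S i (\<lambda>j. 1 - f j) = out_degree G i - ?S i f" for i f
    by (simp add: out_degree_def right_diff_distrib sum_subtractf)
  have S2: "?S i (\<lambda>j. f j + g j) = ?S i f + ?S i g" for i f g
    by (simp add: distrib_left sum.distrib)
  have "?L \<longleftrightarrow> (\<forall>i. v i = (1 - out_degree G i) * (1 - \<gamma>) + ?S i v + (1 - \<gamma>) * ?S i u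
      \<and> u i = \<gamma> * (1 - out_degree G i + ?S i u))"
    unfolding rhs by (subst coeff) rule
  \<comment> \<open>Adding the two equations eliminates \<open>\<gamma>\<close> and gives the first
    system; complementing the equation for \<open>u i\<close> gives the second.\<close>
  also have "\<dots> \<longleftrightarrow> (\<forall>i. 1 - (u i + v i) = 0 + 1 * ?S i (\<lambda>j. 1 - (u j + v j)))
      \<and> (\<forall>i. 1 - u i = (1 - \<gamma>) + \<gamma> * ?S i (\<lambda>j. 1 - u j))"
  proof -
    have "v i = (1 - out_degree G i) * (1 - \<gamma>) + ?S i v + (1 - \<gamma>) * ?S i u
        \<and> u i = \<gamma> * (1 - out_degree G i + ?S i u) \<longleftrightarrow>
      1 - (u i + v i) = 0 + 1 * ?S i (\<lambda>j. 1 - (u j + v j))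
      \<and> 1 - u i = (1 - \<gamma>) + \<gamma> * ?S i (\<lambda>j. 1 - u j)" for i
      unfolding S1 S2 by (auto simp: algebra_simps)
    then show ?thesis by blast
  qed
  \<comment> \<open>The first system is the fixed-point lemma with factor 1 and
    \<open>k = 0\<close>, the second with factor \<open>\<gamma>\<close> and
    \<open>k = 1 - \<gamma>\<close>.\<close>
  also have "\<dots> \<longleftrightarrow> (\<forall>i. 1 - (u i + v i) = 0) \<and> (\<forall>i. 1 - u i = (1 - \<gamma>) * katz_bonacich \<gamma> G $ i)"
    using interaction_network_fixed_point_iff[OF G zero_le_one order_refl, of "\<lambda>i. 1 - (u i + v i)" 0]
      interaction_network_fixed_point_iff[OF G \<gamma>, of "\<lambda>i. 1 - u i" "1 - \<gamma>"]
    by simp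
  also have "\<dots> \<longleftrightarrow> ?R"
  proof -
    have "1 - (u i + v i) = 0 \<and> 1 - u i = z \<longleftrightarrow> v i = z \<and> u i = 1 - v i" for i z
      by auto
    then show ?thesis by (metis (no_types, lifting))
  qed
  finally show ?thesis .
qed

section \<open>Existence and uniqueness of the equilibrium\<close>

theorem proposition1:
  fixes G :: "real^'n::finite^'n" and \<tau>x \<tau>y \<gamma> :: real
  assumes "CARD('n) \<ge> 2"
    and "interaction_network G"
    and "\<tau>x > 0" and "\<tau>y > 0"
    and "\<gamma> = \<tau>x / (\<tau>x + \<tau>y)"
  shows "(\<exists>!s. linear_equilibrium G \<tau>x \<tau>y s) \<and>
    (\<forall>s. linear_equilibrium G \<tau>x \<tau>y s \<longrightarrow>
      (\<forall>i xi y. let b = (1 - \<gamma>) * katz_bonacich \<gamma> G $ i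
                in s i xi y = b * y + (1 - b) * xi))"
proof -
  define b where "b i = (1 - \<gamma>) * katz_bonacich \<gamma> G $ i" for i
  define eq where "eq i xi y = b i * y + (1 - b i) * xi" for i xi y
  have \<gamma>: "0 \<le> \<gamma>" "\<gamma> \<le> 1" using assms(3,4) by (simp_all add: assms(5))
  \<comment> \<open>Read from right to left this yields existence, from left to right
    uniqueness.\<close>
  have iff: "linear_equilibrium G \<tau>x \<tau>y s \<longleftrightarrow> (\<forall>i. v i = b i \<and> u i = 1 - v i)"
    if "\<And>j x y. s j x y = v j * y + u j * x" for s u v
    unfolding linear_equilibrium_iff_best_response[OF assms(1,3-5) that]
      equilibrium_coefficients_iff[OF assms(2) \<gamma>] b_def ..
  have "linear_equilibrium G \<tau>x \<tau>y eq"
    by (subst iff[of eq b "\<lambda>i. 1 - b i"]) (simp_all add: eq_def)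
  moreover have uniq: "s = eq" if s: "linear_equilibrium G \<tau>x \<tau>y s" for s
  proof -
    \<comment> \<open>The coefficients of all agents are chosen at once, which brings
      \<open>s\<close> into the form that \<open>iff\<close> asks for.\<close>
    from s obtain v u where vu: "\<And>j x y. s j x y = v j * y + u j * x"
      unfolding linear_equilibrium_def linear_profile_def by metis
    then show ?thesis using s iff[OF vu] by (simp add: eq_def fun_eq_iff)
  qed
  ultimately have "\<exists>!s. linear_equilibrium G \<tau>x \<tau>y s" by blast
  then show ?thesis
    by (auto simp: Let_def eq_def b_def dest!: uniq)
qed

end
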